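(* Let $N\ge 1$, let $\mathcal{A}_k\in\mathbb{R}^{N\times N}$ be a (sparse) symmetric invertible matrix, and let $\mathcal{Q}_k\in\mathbb{R}^{N\times N}$ be a symmetric positive definite matrix. Assume that there are constants $\underline{C}>0$ and $\overline{C}>0$ such that $$\|\mathcal{Q}_k^{-1/2}\mathcal{A}_k\mathcal{Q}_k^{-1/2}\|\le \overline{C}\qquad\text{and}\qquad \|\mathcal{Q}_k^{1/2}\mathcal{A}_k^{-1}\mathcal{Q}_k^{1/2}\|\le \underline{C}^{-1}.$$ Let $\mathcal{L}_k\in\mathbb{R}^{N\times N}$ be a positive definite diagonal matrix such that $$\|\mathcal{Q}_k^{1/2}\underline{x}_k\|\le\|\mathcal{L}_k^{1/2}\underline{x}_k\|\qquad\text{for all }\underline{x}_k\in\mathbb{R}^N.$$ Define $\mathcal{N}_k:=\mathcal{A}_k^T\mathcal{L}_k^{-1}\mathcal{A}_k$ and $\hat{\mathcal{N}}_k:=\mathrm{tri}(\mathcal{N}_k)\,\mathrm{diag}(\mathcal{N}_k)^{-1}\,\mathrm{tri}(\mathcal{N}_k)^T$. Then the symmetric least squares Gauss Seidel (sLSGS) iteration satisfies the smoothing property; precisely, for every integer $\nu\ge 1$, $$\|\mathcal{L}_k^{-1/2}\mathcal{A}_k(I-\hat{\mathcal{N}}_k^{-1}\mathcal{N}_k)^{\nu}\mathcal{L}_k^{-1/2}\|\le\frac{2^{-1/2}\,\overline{C}\,\mathrm{nnz}(\mathcal{A}_k)^{5/2}}{\sqrt{\nu}}.$$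
   Context: For vectors, $\|\cdot\|$ is the Euclidean norm; for matrices it is the induced spectral norm. $I$ is the identity matrix, and $M^{1/2}$ denotes the symmetric positive definite square root of a symmetric positive definite matrix $M$. For a square matrix $M$: $\mathrm{diag}(M)$ is the diagonal matrix containing the diagonal of $M$; $\mathrm{tri}(M)$ is the matrix whose coefficients coincide with those of $M$ on the diagonal and in the lower-left triangular part and vanish elsewhere; $\mathrm{nnz}(M)$ is the maximum number of non-zero entries per row of $M$. For a linear system $\mathcal{A}_k\underline{x}_k=\underline{f}_k$, the sLSGS iteration is $$\underline{x}^{(0,m)}_k:=\underline{x}^{(0,m-1)}_k+\hat{\mathcal{N}}_k^{-1}\mathcal{A}_k^T\mathcal{L}_k^{-1}\left(\underline{f}_k-\mathcal{A}_k\underline{x}^{(0,m-1)}_k\right),\qquad m=1,\ldots,\nu,$$ so its iteration matrix is $I-\hat{\mathcal{N}}_k^{-1}\mathcal{N}_k$. The smoothing property for an iteration with iteration matrix $I-\hat{\mathcal{A}}_k^{-1}\mathcal{A}_k$ (here $\hat{\mathcal{A}}_k^{-1}=\hat{\mathcal{N}}_k^{-1}\mathcal{A}_k^T\mathcal{L}_k^{-1}$) is the bound $\|\mathcal{L}_k^{-1/2}\mathcal{A}_k(I-\hat{\mathcal{A}}_k^{-1}\mathcal{A}_k)^{\nu}\mathcal{L}_k^{-1/2}\|\le\eta(\nu)$ for some function $\eta$ with $\lim_{\nu\to\infty}\eta(\nu)=0$. The index $k$ denotes the grid level. "Sparse" has no quantitative meaning beyond the appearance of $\mathrm{nnz}(\mathcal{A}_k)$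 in the bound. *)

theory Defs
  imports "HOL-Analysis.Analysis"
begin

type_synonym 'n sqmat = "real^'n^'n"

abbreviation spectral_norm :: "('n::finite) sqmat \<Rightarrow> real" where
  "spectral_norm M \<equiv> onorm ((*v) M)"

definition symmetric_matrix :: "('n::finite) sqmat \<Rightarrow> bool" where
  "symmetric_matrix M \<longleftrightarrow> transpose M = M"

definition pos_def :: "('n::finite) sqmat \<Rightarrow> bool" where
  "pos_def M \<longleftrightarrow> (\<forall>x. x \<noteq> 0 \<longrightarrow> 0 < x \<bullet> (M *v x))"

definition diagonal_matrix :: "('n::finite) sqmat \<Rightarrow> bool" where
  "diagonal_matrix M \<longleftrightarrow> (\<forall>i j. i \<noteq> j \<longrightarrow> M $ i $ j = 0)"

(* Only meaningful for symmetric positive definite M, where the root exists and is unique. *)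
definition matrix_sqrt :: "('n::finite) sqmat \<Rightarrow> 'n sqmat" where
  "matrix_sqrt M = (THE S. symmetric_matrix S \<and> pos_def S \<and> S ** S = M)"

definition matrix_inv_sqrt :: "('n::finite) sqmat \<Rightarrow> 'n sqmat" where
  "matrix_inv_sqrt M = matrix_inv (matrix_sqrt M)"

(* The library's * (and hence any power built on it) is entrywise on matrices,
   so powers with respect to ** are defined here. *)
primrec matrix_pow :: "('n::finite) sqmat \<Rightarrow> nat \<Rightarrow> 'n sqmat" where
  "matrix_pow M 0 = mat 1"
| "matrix_pow M (Suc m) = M ** matrix_pow M m"

definition diag_part :: "('n::finite) sqmat \<Rightarrow> 'n sqmat" where
  "diag_part M = (\<chi> i j. if i = j then M $ i $ j else 0)"

(* The linear order on the index type plays the role of the numbering 1, ..., N of the unknowns. *)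
definition tri :: "('n::{finite,linorder}) sqmat \<Rightarrow> 'n sqmat" where
  "tri M = (\<chi> i j. if j \<le> i then M $ i $ j else 0)"

definition nnz :: "('n::finite) sqmat \<Rightarrow> nat" where
  "nnz M = Max (range (\<lambda>i. card {j. M $ i $ j \<noteq> 0}))"

definition normal_matrix :: "('n::finite) sqmat \<Rightarrow> 'n sqmat \<Rightarrow> 'n sqmat" where
  "normal_matrix L A = transpose A ** matrix_inv L ** A"

definition symmetric_gauss_seidel :: "('n::{finite,linorder}) sqmat \<Rightarrow> 'n sqmat" where
  "symmetric_gauss_seidel M = tri M ** matrix_inv (diag_part M) ** transpose (tri M)"

(* The approximate inverse of A that is applied to the residual in one sLSGS step *)
definition slsgs_approx_inv ::
    "('n::{finite,linorder}) sqmat \<Rightarrow> 'n sqmat \<Rightarrow> 'n sqmat" where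
  "slsgs_approx_inv L A =
     matrix_inv (symmetric_gauss_seidel (normal_matrix L A)) ** transpose A ** matrix_inv L"

definition slsgs_step ::
    "('n::{finite,linorder}) sqmat \<Rightarrow> 'n sqmat \<Rightarrow> (real, 'n) vec \<Rightarrow>
     (real, 'n) vec \<Rightarrow> (real, 'n) vec" where
  "slsgs_step L A f x = x + slsgs_approx_inv L A *v (f - A *v x)"

definition iteration_matrix :: "('n::finite) sqmat \<Rightarrow> 'n sqmat \<Rightarrow> 'n sqmat" where
  "iteration_matrix B A = mat 1 - B ** A"

lemma slsgs_iteration_matrix:
  "iteration_matrix (slsgs_approx_inv L A) A =
     mat 1 - matrix_inv (symmetric_gauss_seidel (normal_matrix L A)) ** normal_matrix L A"
  by (simp add: iteration_matrix_def slsgs_approx_inv_def normal_matrix_def matrix_mul_assoc)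

lemma slsgs_step_error:
  assumes "A *v x = f"
  shows "slsgs_step L A f y - x = iteration_matrix (slsgs_approx_inv L A) A *v (y - x)"
  using assms
  by (simp add: slsgs_step_def iteration_matrix_def matrix_vector_mult_diff_distrib
      matrix_vector_mult_diff_rdistrib matrix_vector_mul_assoc[symmetric] algebra_simps)

definition smoothing_property ::
    "('n::finite) sqmat \<Rightarrow> 'n sqmat \<Rightarrow> 'n sqmat \<Rightarrow> (nat \<Rightarrow> real) \<Rightarrow> bool" where
  "smoothing_property L A B \<eta> \<longleftrightarrow>
     (\<forall>\<nu>\<ge>1. spectral_norm
        (matrix_inv_sqrt L ** A ** matrix_pow (iteration_matrix B A) \<nu> ** matrix_inv_sqrt L)
          \<le> \<eta> \<nu>) \<and>
     \<eta> \<longlonglongrightarrow> 0"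

end

theory Submission
  imports Defs
begin

text \<open>
  Write \<open>N = A L\<^sup>-\<^sup>1 A\<close>, \<open>H\<close> for its symmetric Gauss Seidel preconditioner,
  \<open>E = I - H\<^sup>-\<^sup>1 N\<close> and \<open>J = L\<^sup>-\<^sup>1\<^sup>/\<^sup>2\<close>, so that \<open>N = (J A)\<^sup>T (J A)\<close> and the quantity to
  be bounded is \<open>\<parallel>J A E\<^sup>\<nu> J y\<parallel>\<^sup>2\<close>, the \<open>N\<close>-energy of \<open>E\<^sup>\<nu> z\<close> with \<open>z = J y\<close>.

  The decay in \<open>\<nu>\<close> (\<open>smoothing_energy\<close>) rests on \<open>0 \<le> N \<le> H\<close>. Usually one bounds
  \<open>t (1 - t)\<^sup>2\<^sup>\<nu>\<close> on \<open>[0, 1]\<close> over the spectrum of \<open>H\<^sup>-\<^sup>1 N\<close>. A bound of the same order follows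
  without a spectral decomposition: \<open>E\<close> is self-adjoint for \<open>H\<close>, so the energies
  \<open>a m = z \<bullet> N E\<^sup>m z\<close> are the successive differences of \<open>c m = z \<bullet> H E\<^sup>m z\<close>. They
  decrease, because second differences of \<open>c\<close> are again values of a semidefinite form, and
  their sum telescopes to at most \<open>c 0\<close>. Hence \<open>2 \<nu> + 1\<close> times the last
  of them, \<open>a (2 \<nu>)\<close>, which is the energy of \<open>E\<^sup>\<nu> z\<close>, is at most \<open>z \<bullet> H z\<close>.

  It remains to compare \<open>z \<bullet> H z\<close> with \<open>\<parallel>y\<parallel>\<^sup>2\<close>. The form of \<open>H\<close> dominates that of \<open>N\<close> by a
  completed square (\<open>symmetric_gauss_seidel_ge\<close>). From above it is controlled by the
  diagonal of \<open>N\<close> (\<open>symmetric_gauss_seidel_le\<close>), since each entry of a positive definite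
  matrix is in modulus at most the geometric mean of two diagonal entries and a row of \<open>N\<close> has at
  most \<open>(nnz A)\<^sup>2\<close> nonzeros (\<open>nnz_normal_matrix_le\<close>). The diagonal entries of \<open>N\<close> are
  squared column norms of \<open>J A\<close>, hence are governed by \<open>\<parallel>J A J\<parallel>\<close>, and \<open>Q \<le> L\<close> transfers the
  bound on \<open>Q\<^sup>-\<^sup>1\<^sup>/\<^sup>2 A Q\<^sup>-\<^sup>1\<^sup>/\<^sup>2\<close> to \<open>J A J\<close> (\<open>scaled_norm_le\<close>).

  This last step uses that \<open>Q\<^sup>1\<^sup>/\<^sup>2\<close> is symmetric and invertible. As \<open>matrix_sqrt\<close> is a
  definite description, existence and uniqueness of the root have to be shown
  (\<open>pos_def_sqrt_exists\<close>, \<open>pos_def_sqrt_unique\<close>).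
\<close>

section \<open>Symmetric and positive definite matrices\<close>

lemma inner_transpose_mult: "x \<bullet> (transpose M *v y) = (M *v x) \<bullet> (y::real^'n)"
  for M :: "('n::finite) sqmat"
  by (metis dot_lmul_matrix inner_commute transpose_matrix_vector)

lemma symmetric_matrix_inner:
  "symmetric_matrix M \<Longrightarrow> x \<bullet> (M *v y) = (M *v x) \<bullet> y"
  using inner_transpose_mult[of x M y] by (simp add: symmetric_matrix_def)

lemma symmetric_matrix_nth:
  assumes "symmetric_matrix M"
  shows "M $ i $ j = M $ j $ i"
proof -
  have "transpose M $ i $ j = M $ i $ j" using assms by (simp add: symmetric_matrix_def)
  then show ?thesis by (simp add: transpose_def)
qed

lemma symmetric_matrixI:
  assumes "\<And>x y. x \<bullet> (M *v y) = (M *v x) \<bullet> y"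
  shows "symmetric_matrix M"
proof -
  have "transpose M *v y = M *v y" for y
    by (rule vector_eq_rdot[THEN iffD1])
      (metis assms inner_commute inner_transpose_mult)
  then show ?thesis
    unfolding symmetric_matrix_def by (simp add: matrix_eq)
qed

lemma matrix_entry_inner: "M $ i $ j = axis i 1 \<bullet> (M *v axis j 1)" for M :: "('n::finite) sqmat"
  by (simp add: inner_axis' matrix_vector_mult_basis column_def)

lemma pos_def_nonneg: "pos_def M \<Longrightarrow> 0 \<le> x \<bullet> (M *v x)"
  by (cases "x = 0") (auto simp: pos_def_def intro: less_imp_le)

lemma pos_def_invertible: "pos_def M \<Longrightarrow> invertible M"
  unfolding invertible_left_inverse matrix_left_invertible_ker pos_def_def
  by (metis inner_zero_right less_irrefl)

lemma matrix_inv_mult: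
  assumes "invertible M"
  shows "M ** matrix_inv M = mat 1" "matrix_inv M ** M = mat 1"
proof -
  from assms have "M ** matrix_inv M = mat 1 \<and> matrix_inv M ** M = mat 1"
    unfolding invertible_def matrix_inv_def by (rule someI_ex)
  then show "M ** matrix_inv M = mat 1" "matrix_inv M ** M = mat 1" by auto
qed

lemma matrix_inv_unique_left:
  fixes M P :: "('n::finite) sqmat"
  assumes "P ** M = mat 1"
  shows "matrix_inv M = P"
proof -
  have "invertible M" using assms unfolding invertible_left_inverse by blast
  then have "P ** (M ** matrix_inv M) = P" by (simp add: matrix_inv_mult)
  then show ?thesis by (simp add: matrix_mul_assoc assms)
qed

section \<open>Square roots of positive definite matrices\<close>

text \<open>The smallest value of the quadratic form on the unit sphere is attained by compactness, hence positive.\<close>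

lemma pos_def_coercive:
  fixes M :: "('n::finite) sqmat"
  assumes "pos_def M"
  obtains \<mu> where "\<mu> > 0" "\<And>x. \<mu> * (norm x)\<^sup>2 \<le> x \<bullet> (M *v x)"
proof -
  have ne: "sphere (0::real^'n) 1 \<noteq> {}" by simp
  have "continuous_on (sphere 0 1) (\<lambda>x. x \<bullet> (M *v x))"
    by (intro continuous_intros linear_continuous_on matrix_vector_mul_bounded_linear)
  then obtain u where u: "u \<in> sphere 0 1"
    and min: "\<And>x. x \<in> sphere 0 1 \<Longrightarrow> u \<bullet> (M *v u) \<le> x \<bullet> (M *v x)"
    using continuous_attains_inf[OF compact_sphere ne] by blast
  from u have "u \<noteq> 0" by auto
  then have pos: "0 < u \<bullet> (M *v u)" using assms by (simp add: pos_def_def)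
  have "u \<bullet> (M *v u) * (norm x)\<^sup>2 \<le> x \<bullet> (M *v x)" for x
  proof (cases "x = 0")
    case False
    have "u \<bullet> (M *v u) \<le> (x /\<^sub>R norm x) \<bullet> (M *v (x /\<^sub>R norm x))"
      using False by (intro min) simp
    also have "\<dots> = x \<bullet> (M *v x) / (norm x)\<^sup>2"
      by (simp add: matrix_vector_mult_scaleR power2_eq_square divide_inverse)
    finally show ?thesis using False by (simp add: field_simps)
  qed simp
  with pos show ?thesis using that by blast
qed

text \<open>
  The ansatz \<open>S = (I - Y) / \<surd>t\<close> turns \<open>S\<^sup>2 = M\<close> into the fixed point equation
  \<open>Y = (X + Y\<^sup>2) / 2\<close> with \<open>X = I - t M\<close>. For small \<open>t > 0\<close> coercivity makes \<open>\<parallel>X\<parallel> \<le> q < 1\<close>, and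
  then the right-hand side is a contraction of the closed set of symmetric operators of
  norm at most \<open>q\<close>. Banach's theorem yields \<open>Y\<close>, and \<open>\<parallel>Y\<parallel> < 1\<close> makes \<open>I - Y\<close> positive
  definite. Operators rather than matrices are used because the norm of the former is
  the operator norm.
\<close>

lemma pos_def_sqrt_exists:
  fixes M :: "('n::finite) sqmat"
  assumes sym: "symmetric_matrix M" and pd: "pos_def M"
  shows "\<exists>S. symmetric_matrix S \<and> pos_def S \<and> S ** S = M"
proof -
  obtain \<mu> where \<mu>: "\<mu> > 0" "\<And>x. \<mu> * (norm x)\<^sup>2 \<le> x \<bullet> (M *v x)"
    using pos_def_coercive[OF pd] by blast
  obtain K\<^sub>0 where K0: "K\<^sub>0 > 0" "\<And>x. norm (M *v x) \<le> norm x * K\<^sub>0"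
    using bounded_linear.pos_bounded[OF matrix_vector_mul_bounded_linear[of M]] by blast
  \<comment> \<open>Adding \<open>\<mu>\<close> ensures \<open>\<mu> < K\<close>, so that the square root defining \<open>q\<close> is real and below 1.\<close>
  define K where "K = K\<^sub>0 + \<mu>"
  have K: "K > 0" "\<mu> < K" using K0 \<mu> by (auto simp: K_def)
  have normM: "norm (M *v x) \<le> K * norm x" for x
  proof -
    have "0 \<le> \<mu> * norm x" using \<mu>(1) by simp
    then show ?thesis using K0(2)[of x] by (simp add: K_def algebra_simps)
  qed
  \<comment> \<open>This \<open>t\<close> minimises \<open>1 - 2 t \<mu> + t\<^sup>2 K\<^sup>2\<close>, the bound for \<open>\<parallel>I - t M\<parallel>\<^sup>2\<close>; the minimum is \<open>q\<^sup>2\<close>.\<close>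
  define t where "t = \<mu> / K\<^sup>2"
  have t: "t > 0" using \<mu> K by (simp add: t_def)
  define q where "q = sqrt (1 - (\<mu> / K)\<^sup>2)"
  have "0 < (\<mu> / K)\<^sup>2" "(\<mu> / K)\<^sup>2 < 1"
    using \<mu> K by (auto simp: power_less_one_iff abs_square_less_1)
  then have q: "0 \<le> q" "q < 1" and q2: "q\<^sup>2 = 1 - (\<mu> / K)\<^sup>2" by (auto simp: q_def)
  define X :: "(real^'n) \<Rightarrow>\<^sub>L (real^'n)" where "X = Blinfun (\<lambda>x. x - t *\<^sub>R (M *v x))"
  have X: "blinfun_apply X x = x - t *\<^sub>R (M *v x)" for x
  proof -
    have "bounded_linear (\<lambda>x. x - t *\<^sub>R (M *v x))"
      by (intro bounded_linear_intros matrix_vector_mul_bounded_linear)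
    then show ?thesis by (simp add: X_def bounded_linear_Blinfun_apply)
  qed
  have normX: "norm X \<le> q"
  proof (rule norm_blinfun_bound[OF q(1)])
    fix x
    have "(norm (X x))\<^sup>2 = (norm x)\<^sup>2 - 2 * t * (x \<bullet> (M *v x)) + t\<^sup>2 * (norm (M *v x))\<^sup>2"
      unfolding X power2_norm_eq_inner
      by (simp add: inner_diff_left inner_diff_right inner_commute power2_eq_square algebra_simps)
    also have "\<dots> \<le> (norm x)\<^sup>2 - 2 * t * (\<mu> * (norm x)\<^sup>2) + t\<^sup>2 * (K * norm x)\<^sup>2"
      using t \<mu>(2)[of x] normM[of x]
      by (intro add_mono diff_mono mult_left_mono power_mono) auto
    also have "\<dots> = (q * norm x)\<^sup>2"
      using K(1) unfolding power_mult_distrib q2 t_def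
      by (simp add: field_simps power2_eq_square)
    finally show "norm (X x) \<le> q * norm x"
      by (rule power2_le_imp_le) (simp add: q)
  qed
  define F where "F = (\<lambda>Y. (1/2) *\<^sub>R (X + (Y o\<^sub>L Y)))"
  define \<S> :: "((real^'n) \<Rightarrow>\<^sub>L (real^'n)) set"
    where "\<S> = {Y. norm Y \<le> q} \<inter> (\<Inter>x. \<Inter>y. {Y. blinfun_apply Y x \<bullet> y = x \<bullet> blinfun_apply Y y})"
  have "closed \<S>"
    unfolding \<S>_def by (intro closed_Int closed_INT ballI closed_Collect_le closed_Collect_eq continuous_intros)
  then have "complete \<S>" by (simp add: complete_eq_closed)
  moreover have "\<S> \<noteq> {}"
  proof -
    have "0 \<in> \<S>" by (simp add: \<S>_def q)
    then show ?thesis by blast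
  qed
  moreover have "F ` \<S> \<subseteq> \<S>"
  proof (rule image_subsetI)
    fix Y assume "Y \<in> \<S>"
    then have nY: "norm Y \<le> q" and sY: "\<And>x y. Y x \<bullet> y = x \<bullet> Y y" by (auto simp: \<S>_def)
    have "norm (Y o\<^sub>L Y) \<le> norm Y * norm Y" by (rule norm_blinfun_compose)
    also have "\<dots> \<le> q * 1" using nY q by (intro mult_mono) auto
    finally have "norm (X + (Y o\<^sub>L Y)) \<le> 2 * q"
      using normX norm_triangle_ineq[of X "Y o\<^sub>L Y"] by linarith
    moreover have "X x \<bullet> y = x \<bullet> X y" for x y
      by (simp add: X inner_diff_left inner_diff_right symmetric_matrix_inner[OF sym])
    ultimately show "F Y \<in> \<S>"
      by (simp add: \<S>_def F_def blinfun.bilinear_simps inner_add_left inner_add_right sY)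
  qed
  moreover have "dist (F Y) (F Z) \<le> q * dist Y Z" if "Y \<in> \<S>" "Z \<in> \<S>" for Y Z
  proof -
    have n: "norm Y \<le> q" "norm Z \<le> q" using that by (auto simp: \<S>_def)
    \<comment> \<open>Noncommutative difference of squares: \<open>Y\<^sup>2 - Z\<^sup>2 = Y (Y - Z) + (Y - Z) Z\<close>.\<close>
    have "F Y - F Z = (1/2) *\<^sub>R ((Y o\<^sub>L (Y - Z)) + ((Y - Z) o\<^sub>L Z))"
      by (rule blinfun_eqI) (simp add: F_def blinfun.bilinear_simps algebra_simps)
    also have "norm \<dots> \<le> (1/2) * (norm Y * norm (Y - Z) + norm (Y - Z) * norm Z)"
      using norm_triangle_ineq[of "Y o\<^sub>L (Y - Z)" "(Y - Z) o\<^sub>L Z"]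
        norm_blinfun_compose[of Y "Y - Z"] norm_blinfun_compose[of "Y - Z" Z]
      by simp
    also have "\<dots> \<le> (1/2) * (q * norm (Y - Z) + norm (Y - Z) * q)"
      using n q by (intro mult_left_mono add_mono mult_mono) auto
    finally show ?thesis by (simp add: dist_norm)
  qed
  ultimately obtain Y where Y: "Y \<in> \<S>" "F Y = Y"
    using Banach_fix[of \<S> q F] q by blast
  have nY: "norm Y \<le> q" and sY: "\<And>x y. Y x \<bullet> y = x \<bullet> Y y" using Y(1) by (auto simp: \<S>_def)
  have Y2: "2 *\<^sub>R Y x = X x + Y (Y x)" for x
    using arg_cong[OF Y(2), of "\<lambda>Z. 2 *\<^sub>R blinfun_apply Z x"]
    by (simp add: F_def blinfun.bilinear_simps)
  define r where "r = 1 / sqrt t"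
  have r: "r > 0" "r * r = 1 / t" using t by (auto simp: r_def)
  define S where "S = matrix (\<lambda>x. r *\<^sub>R (x - Y x))"
  have S: "S *v x = r *\<^sub>R (x - Y x)" for x
  proof -
    have "linear (\<lambda>x. r *\<^sub>R (x - Y x))"
      by (intro bounded_linear.linear bounded_linear_intros blinfun.bounded_linear_right)
    then show ?thesis unfolding S_def by (simp add: matrix_works scalar_mult_eq_scaleR)
  qed
  have "symmetric_matrix S"
    by (rule symmetric_matrixI) (simp add: S inner_diff_left inner_diff_right sY)
  moreover have "pos_def S"
    unfolding pos_def_def
  proof (intro allI impI)
    fix x :: "real^'n" assume "x \<noteq> 0"
    have "x \<bullet> Y x \<le> norm x * norm (Y x)" by (rule norm_cauchy_schwarz)
    also have "\<dots> \<le> norm x * (q * norm x)"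
      using norm_blinfun[of Y x] nY mult_right_mono[OF nY, of "norm x"]
      by (intro mult_left_mono) auto
    also have "\<dots> = q * (x \<bullet> x)" by (simp add: dot_square_norm power2_eq_square)
    also have "\<dots> < x \<bullet> x" using q \<open>x \<noteq> 0\<close> by simp
    finally show "0 < x \<bullet> (S *v x)" using r by (simp add: S inner_diff_right)
  qed
  moreover have "S ** S = M"
  proof -
    have "S *v (S *v x) = M *v x" for x
    proof -
      have "S *v (S *v x) = (r * r) *\<^sub>R (x - 2 *\<^sub>R Y x + Y (Y x))"
        by (simp add: S blinfun.bilinear_simps scaleR_diff_right scaleR_add_right scaleR_2)
      also have "\<dots> = M *v x" using t by (simp add: Y2 X r)
      finally show ?thesis .
    qed
    then show ?thesis by (simp add: matrix_eq flip: matrix_vector_mul_assoc)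
  qed
  ultimately show ?thesis by blast
qed

text \<open>
  With \<open>K = S - T\<close>, equality of the squares says \<open>K S = - T K\<close>. Hence \<open>K S K\<close> and \<open>K T K\<close>
  have opposite traces, but both traces are sums of nonnegative values of quadratic forms,
  so all these values vanish.
\<close>

lemma pos_def_sqrt_unique:
  fixes S T :: "('n::finite) sqmat"
  assumes S: "symmetric_matrix S" "pos_def S" and T: "symmetric_matrix T" "pos_def T"
    and eq: "S ** S = T ** T"
  shows "S = T"
proof -
  define K where "K = S - T"
  have symK: "symmetric_matrix K"
    using S T unfolding K_def symmetric_matrix_def by (simp add: transpose_def vec_eq_iff)
  have "K *v (S *v x) = - (T *v (K *v x))" for x
    using arg_cong[OF eq, of "\<lambda>M. M *v x"]
    by (simp add: K_def matrix_vector_mult_diff_rdistrib matrix_vector_mult_diff_distrib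
        flip: matrix_vector_mul_assoc)
  then have "(K ** S ** K + T ** (K ** K)) *v x = 0 *v x" for x
    by (simp add: matrix_vector_mult_add_rdistrib flip: matrix_vector_mul_assoc)
  then have KSK: "K ** S ** K + T ** (K ** K) = 0" by (simp add: matrix_eq)
  have tr: "trace (K ** P ** K) = (\<Sum>i\<in>UNIV. (K *v axis i 1) \<bullet> (P *v (K *v axis i 1)))" for P
  proof -
    have "(K ** P ** K) $ i $ i = (K *v axis i 1) \<bullet> (P *v (K *v axis i 1))" for i
      by (simp add: matrix_entry_inner symmetric_matrix_inner[OF symK] flip: matrix_vector_mul_assoc)
    then show ?thesis by (simp add: trace_def)
  qed
  have "trace (K ** S ** K) + trace (T ** (K ** K)) = 0"
    unfolding trace_add[symmetric] KSK by (simp add: trace_def)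
  moreover have "trace (T ** (K ** K)) = trace (K ** T ** K)"
    by (metis matrix_mul_assoc trace_mul_sym)
  moreover have "0 \<le> trace (K ** T ** K)"
    unfolding tr by (intro sum_nonneg pos_def_nonneg[OF T(2)])
  ultimately have "trace (K ** S ** K) \<le> 0" by simp
  then have "(K *v axis i 1) \<bullet> (S *v (K *v axis i 1)) = 0" for i
    unfolding tr using pos_def_nonneg[OF S(2)]
    by (metis (no_types, lifting) UNIV_I finite sum_nonneg sum_nonneg_0 order_antisym)
  then have Kz: "K *v axis i 1 = 0" for i
    using S(2) unfolding pos_def_def by (metis less_irrefl)
  have "K = 0"
    by (simp add: vec_eq_iff matrix_entry_inner[of K] Kz)
  then show ?thesis by (simp add: K_def)
qed

lemma matrix_sqrt_eqI:
  assumes "symmetric_matrix S" "pos_def S" "S ** S = M"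
  shows "matrix_sqrt M = S"
  unfolding matrix_sqrt_def
proof (rule the_equality)
  show "symmetric_matrix S \<and> pos_def S \<and> S ** S = M" using assms by simp
next
  fix T assume "symmetric_matrix T \<and> pos_def T \<and> T ** T = M"
  then show "T = S" using pos_def_sqrt_unique[of T S] assms by simp
qed

lemma
  assumes "symmetric_matrix M" "pos_def M"
  shows symmetric_matrix_sqrt: "symmetric_matrix (matrix_sqrt M)"
    and pos_def_matrix_sqrt: "pos_def (matrix_sqrt M)"
proof -
  obtain S where S: "symmetric_matrix S" "pos_def S" "S ** S = M"
    using pos_def_sqrt_exists[OF assms] by auto
  from S show "symmetric_matrix (matrix_sqrt M)" "pos_def (matrix_sqrt M)"
    by (simp_all add: matrix_sqrt_eqI)
qed

section \<open>Diagonal matrices\<close>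

definition diag_of :: "('n::finite \<Rightarrow> real) \<Rightarrow> 'n sqmat" where
  "diag_of d = (\<chi> i j. if i = j then d i else 0)"

lemma diag_of_nth: "diag_of d $ i $ j = (if i = j then d i else 0)"
  by (simp add: diag_of_def)

lemma diag_of_mult_vec: "(diag_of d *v x) $ i = d i * x $ i"
  by (simp add: diag_of_def matrix_vector_mult_def if_distrib[of "\<lambda>c. c * _"] cong: if_cong)

lemma diag_of_mult: "diag_of d ** diag_of e = diag_of (\<lambda>i. d i * e i)"
proof -
  have "(diag_of d ** diag_of e) *v x = diag_of (\<lambda>i. d i * e i) *v x" for x
    by (simp add: vec_eq_iff diag_of_mult_vec flip: matrix_vector_mul_assoc)
  then show ?thesis by (simp add: matrix_eq)
qed

lemma symmetric_diag_of: "symmetric_matrix (diag_of d)"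
  by (simp add: symmetric_matrix_def diag_of_def transpose_def vec_eq_iff)

lemma matrix_inv_diag_of:
  assumes "\<And>i. d i \<noteq> 0"
  shows "matrix_inv (diag_of d) = diag_of (\<lambda>i. 1 / d i)"
  by (rule matrix_inv_unique_left)
    (simp add: diag_of_mult assms, simp add: diag_of_def mat_def)

lemma pos_def_diag_of:
  assumes "\<And>i. d i > 0"
  shows "pos_def (diag_of d)"
  unfolding pos_def_def
proof (intro allI impI)
  fix x :: "real^'a" assume "x \<noteq> 0"
  then obtain i where i: "x $ i \<noteq> 0" by (auto simp: vec_eq_iff)
  have "0 < (\<Sum>i\<in>UNIV. d i * (x $ i)\<^sup>2)"
    by (rule sum_pos2[of _ i]) (use i assms in \<open>auto intro!: mult_nonneg_nonneg intro: less_imp_le\<close>)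
  then show "0 < x \<bullet> (diag_of d *v x)"
    by (simp add: inner_vec_def diag_of_mult_vec power2_eq_square ac_simps)
qed

lemma pos_def_diagonal_entry: "pos_def M \<Longrightarrow> 0 < M $ i $ i"
  by (simp add: matrix_entry_inner pos_def_def)

lemma matrix_sqrt_diag_of:
  assumes "\<And>i. d i > 0"
  shows "matrix_sqrt (diag_of d) = diag_of (\<lambda>i. sqrt (d i))"
  by (rule matrix_sqrt_eqI)
    (use assms in \<open>auto simp: symmetric_diag_of diag_of_mult less_imp_le intro!: pos_def_diag_of\<close>)

section \<open>The symmetric Gauss Seidel preconditioner\<close>

lemma symmetric_gauss_seidel_eq:
  assumes "pos_def N"
  shows "symmetric_gauss_seidel N = tri N ** diag_of (\<lambda>i. 1 / N $ i $ i) ** transpose (tri N)"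
proof -
  have "diag_part N = diag_of (\<lambda>i. N $ i $ i)"
    by (simp add: diag_part_def diag_of_def vec_eq_iff)
  moreover have "N $ i $ i \<noteq> 0" for i
    using pos_def_diagonal_entry[OF assms, of i] by simp
  ultimately show ?thesis
    by (simp add: symmetric_gauss_seidel_def matrix_inv_diag_of)
qed

lemma symmetric_symmetric_gauss_seidel:
  assumes "pos_def N"
  shows "symmetric_matrix (symmetric_gauss_seidel N)"
  by (simp add: symmetric_diag_of[unfolded symmetric_matrix_def] symmetric_matrix_def
      symmetric_gauss_seidel_eq[OF assms] matrix_transpose_mul
      matrix_mul_assoc)

lemma symmetric_gauss_seidel_form:
  assumes "pos_def N"
  shows "x \<bullet> (symmetric_gauss_seidel N *v x)
    = (\<Sum>j\<in>UNIV. ((transpose (tri N) *v x) $ j)\<^sup>2 / N $ j $ j)"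
proof -
  have "x \<bullet> (symmetric_gauss_seidel N *v x)
    = (transpose (tri N) *v x) \<bullet> (diag_of (\<lambda>i. 1 / N $ i $ i) *v (transpose (tri N) *v x))"
    using inner_transpose_mult[of x "transpose (tri N)"]
    unfolding symmetric_gauss_seidel_eq[OF assms]
    by (simp only: transpose_transpose flip: matrix_vector_mul_assoc)
  then show ?thesis
    by (simp add: inner_vec_def diag_of_mult_vec power2_eq_square del: transpose_matrix_vector)
qed

text \<open>
  With \<open>D\<close> the diagonal of \<open>N\<close>, \<open>T = tri N\<close> and \<open>v = T\<^sup>T x\<close>, the splitting \<open>N = T + T\<^sup>T - D\<close>
  gives \<open>x \<bullet> N x = 2 x \<bullet> v - x \<bullet> D x\<close>, which falls short of \<open>v \<bullet> D\<^sup>-\<^sup>1 v = x \<bullet> H x\<close> by the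
  square of \<open>v - D x\<close> weighted with \<open>D\<^sup>-\<^sup>1\<close>.
\<close>

lemma symmetric_gauss_seidel_ge:
  assumes sym: "symmetric_matrix N" and pd: "pos_def N"
  shows "x \<bullet> (N *v x) \<le> x \<bullet> (symmetric_gauss_seidel N *v x)"
proof -
  define v where "v = transpose (tri N) *v x"
  have "N $ i $ j = N $ j $ i" for i j
    using symmetric_matrix_nth[OF sym] .
  then have split: "N = tri N + transpose (tri N) - diag_of (\<lambda>i. N $ i $ i)"
    by (auto simp: tri_def transpose_def diag_of_def vec_eq_iff)
  have "x \<bullet> (N *v x) = x \<bullet> (tri N *v x) + x \<bullet> v - x \<bullet> (diag_of (\<lambda>i. N $ i $ i) *v x)"
    using arg_cong[OF split, of "\<lambda>M. x \<bullet> (M *v x)"] unfolding v_def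
    by (simp only: inner_add_right inner_diff_right matrix_vector_mult_add_rdistrib
        matrix_vector_mult_diff_rdistrib)
  also have "x \<bullet> (tri N *v x) = x \<bullet> v"
    unfolding v_def inner_transpose_mult by (rule inner_commute)
  also have "x \<bullet> v + x \<bullet> v - x \<bullet> (diag_of (\<lambda>i. N $ i $ i) *v x)
    = (\<Sum>j\<in>UNIV. 2 * x $ j * v $ j - N $ j $ j * (x $ j)\<^sup>2)"
    by (simp add: inner_vec_def diag_of_mult_vec power2_eq_square algebra_simps
        flip: sum.distrib sum_subtractf)
  also have "\<dots> \<le> (\<Sum>j\<in>UNIV. (v $ j)\<^sup>2 / N $ j $ j)"
  proof (rule sum_mono)
    fix j
    have d: "0 < N $ j $ j" using pos_def_diagonal_entry[OF pd] .
    have "0 \<le> (v $ j - N $ j $ j * x $ j)\<^sup>2 / N $ j $ j" using d by simp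
    also have "\<dots> = (v $ j)\<^sup>2 / N $ j $ j - (2 * x $ j * v $ j - N $ j $ j * (x $ j)\<^sup>2)"
      using d by (simp add: field_simps power2_eq_square)
    finally show "2 * x $ j * v $ j - N $ j $ j * (x $ j)\<^sup>2 \<le> (v $ j)\<^sup>2 / N $ j $ j" by simp
  qed
  finally show ?thesis by (simp add: symmetric_gauss_seidel_form[OF pd] v_def)
qed

text \<open>Nonnegativity of the form on the span of two coordinate vectors.\<close>

lemma pos_def_entry_bound:
  assumes sym: "symmetric_matrix N" and pd: "pos_def N"
  shows "(N $ i $ j)\<^sup>2 \<le> N $ i $ i * N $ j $ j"
proof -
  \<comment> \<open>The minimiser of \<open>t \<mapsto> (e\<^sub>i - t e\<^sub>j) \<bullet> N (e\<^sub>i - t e\<^sub>j)\<close>.\<close>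
  define t where "t = N $ i $ j / N $ j $ j"
  have d: "0 < N $ j $ j" using pos_def_diagonal_entry[OF pd] .
  have "N $ j $ i = N $ i $ j"
    using symmetric_matrix_nth[OF sym] .
  then have "(axis i 1 - t *\<^sub>R axis j 1) \<bullet> (N *v (axis i 1 - t *\<^sub>R axis j 1))
    = N $ i $ i - 2 * t * N $ i $ j + t\<^sup>2 * N $ j $ j"
    by (simp add: matrix_vector_mult_diff_distrib matrix_vector_mult_scaleR inner_diff_left
        inner_diff_right power2_eq_square algebra_simps flip: matrix_entry_inner)
  then have "0 \<le> N $ i $ i - 2 * t * N $ i $ j + t\<^sup>2 * N $ j $ j"
    using pos_def_nonneg[OF pd] by metis
  also have "\<dots> = N $ i $ i - (N $ i $ j)\<^sup>2 / N $ j $ j"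
    using d by (simp add: t_def field_simps power2_eq_square)
  finally show ?thesis using d by (simp add: field_simps)
qed

lemma card_row_le_nnz: "card {j. M $ i $ j \<noteq> 0} \<le> nnz M"
  unfolding nnz_def by (rule Max_ge) auto

text \<open>
  Each component of \<open>(tri N)\<^sup>T x\<close> is a sum of at most \<open>nnz N\<close> terms. Cauchy-Schwarz costs one
  factor \<open>nnz N\<close>; by \<open>pos_def_entry_bound\<close> the diagonal entry in the denominator cancels.
  Interchanging the sums costs the second factor, because each index \<open>i\<close> occurs once for
  every nonzero of row \<open>i\<close>.
\<close>

lemma symmetric_gauss_seidel_le:
  assumes sym: "symmetric_matrix N" and pd: "pos_def N"
  shows "x \<bullet> (symmetric_gauss_seidel N *v x)
    \<le> (real (nnz N))\<^sup>2 * (\<Sum>i\<in>UNIV. N $ i $ i * (x $ i)\<^sup>2)"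
proof -
  let ?K = "real (nnz N)"
  have symN: "N $ i $ j = N $ j $ i" for i j
    using symmetric_matrix_nth[OF sym] .
  have d: "0 < N $ j $ j" for j using pos_def_diagonal_entry[OF pd] .
  have card: "real (card {i. N $ i $ j \<noteq> 0}) \<le> ?K" for j
    using card_row_le_nnz[of N j] symN by simp
  have "((transpose (tri N) *v x) $ j)\<^sup>2 / N $ j $ j
      \<le> ?K * (\<Sum>i | N $ i $ j \<noteq> 0. N $ i $ i * (x $ i)\<^sup>2)" for j
  proof -
    let ?I = "{i. N $ i $ j \<noteq> 0}"
    have "(transpose (tri N) *v x) $ j = (\<Sum>i\<in>?I. tri N $ i $ j * x $ i)"
      by (auto simp: matrix_vector_mult_def transpose_def tri_def simp del: transpose_matrix_vector
          split: if_splits intro!: sum.mono_neutral_right)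
    then have "((transpose (tri N) *v x) $ j)\<^sup>2 = (\<Sum>i\<in>?I. tri N $ i $ j * x $ i)\<^sup>2" by simp
    also have "\<dots> \<le> card ?I * (\<Sum>i\<in>?I. (tri N $ i $ j * x $ i)\<^sup>2)"
      using sum_squared_le_sum_of_squares[of "\<lambda>i. tri N $ i $ j * x $ i" ?I] by (simp add: mult.commute)
    also have "\<dots> \<le> ?K * (\<Sum>i\<in>?I. N $ j $ j * (N $ i $ i * (x $ i)\<^sup>2))"
    proof (rule mult_mono[OF card sum_mono])
      fix i
      have "(tri N $ i $ j)\<^sup>2 \<le> N $ j $ j * N $ i $ i"
        using pos_def_entry_bound[OF sym pd, of i j] d[of i] d[of j] by (simp add: tri_def mult.commute)
      from mult_right_mono[OF this zero_le_power2[of "x $ i"]]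
      show "(tri N $ i $ j * x $ i)\<^sup>2 \<le> N $ j $ j * (N $ i $ i * (x $ i)\<^sup>2)"
        by (simp only: power_mult_distrib mult.assoc)
    qed (simp_all add: sum_nonneg)
    also have "\<dots> = ?K * (\<Sum>i\<in>?I. N $ i $ i * (x $ i)\<^sup>2) * N $ j $ j"
      unfolding sum_distrib_left[of "N $ j $ j", symmetric] by (simp only: ac_simps)
    finally show ?thesis using d[of j] by (simp only: pos_divide_le_eq)
  qed
  then have "x \<bullet> (symmetric_gauss_seidel N *v x)
      \<le> (\<Sum>j\<in>UNIV. ?K * (\<Sum>i | N $ i $ j \<noteq> 0. N $ i $ i * (x $ i)\<^sup>2))"
    unfolding symmetric_gauss_seidel_form[OF pd] by (rule sum_mono)
  also have "\<dots> = ?K * (\<Sum>j\<in>UNIV. \<Sum>i | N $ i $ j \<noteq> 0. N $ i $ i * (x $ i)\<^sup>2)"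
    by (rule sum_distrib_left[symmetric])
  also have "\<dots> = ?K * (\<Sum>i\<in>UNIV. \<Sum>j | N $ i $ j \<noteq> 0. N $ i $ i * (x $ i)\<^sup>2)"
    using sum.swap_restrict[of UNIV UNIV "\<lambda>j i. N $ i $ i * (x $ i)\<^sup>2" "\<lambda>j i. N $ i $ j \<noteq> 0"]
    by (simp only: UNIV_I simp_thms finite)
  also have "\<dots> \<le> ?K * (\<Sum>i\<in>UNIV. ?K * (N $ i $ i * (x $ i)\<^sup>2))"
  proof (rule mult_left_mono[OF sum_mono])
    fix i
    show "(\<Sum>j | N $ i $ j \<noteq> 0. N $ i $ i * (x $ i)\<^sup>2) \<le> ?K * (N $ i $ i * (x $ i)\<^sup>2)"
      using mult_right_mono[of "real (card {j. N $ i $ j \<noteq> 0})" ?K "N $ i $ i * (x $ i)\<^sup>2"]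
        card_row_le_nnz[of N i] d[of i] by simp
  qed simp
  also have "\<dots> = ?K\<^sup>2 * (\<Sum>i\<in>UNIV. N $ i $ i * (x $ i)\<^sup>2)"
    unfolding sum_distrib_left[symmetric] power2_eq_square mult.assoc ..
  finally show ?thesis .
qed

section \<open>Energy decay of a preconditioned iteration\<close>

text \<open>
  The condition \<open>H E = H - N\<close> says \<open>E = I - H\<^sup>-\<^sup>1 N\<close> without an inverse. In the spectral picture
  the bound expresses \<open>(m + 1) t (1 - t)\<^sup>m \<le> (\<Sum>k\<le>m. t (1 - t)\<^sup>k) \<le> 1\<close> for \<open>t \<in> [0, 1]\<close> and
  \<open>m = 2 \<nu>\<close>.
\<close>

lemma smoothing_energy:
  assumes symN: "symmetric_matrix N" and symH: "symmetric_matrix H"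
    and N0: "\<And>x. 0 \<le> x \<bullet> (N *v x)" and NH: "\<And>x. x \<bullet> (N *v x) \<le> x \<bullet> (H *v x)"
    and HE: "H ** E = H - N"
  shows "(2 * real \<nu> + 1) * ((matrix_pow E \<nu> *v z) \<bullet> (N *v (matrix_pow E \<nu> *v z))) \<le> z \<bullet> (H *v z)"
proof -
  have HE_vec: "H *v (E *v x) = H *v x - N *v x" for x
    using arg_cong[OF HE, of "\<lambda>M. M *v x"]
    by (simp add: matrix_vector_mult_diff_rdistrib flip: matrix_vector_mul_assoc)
  have adj: "(E *v x) \<bullet> (H *v y) = x \<bullet> (H *v (E *v y))" for x y
    by (simp add: HE_vec inner_diff_left inner_diff_right symmetric_matrix_inner[OF symH]
        symmetric_matrix_inner[OF symN])
  have pow_E: "matrix_pow E m *v (E *v x) = E *v (matrix_pow E m *v x)" for m x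
    by (induction m) (simp_all flip: matrix_vector_mul_assoc)
  define c where "c = (\<lambda>w m. w \<bullet> (H *v (matrix_pow E m *v w)))"
  \<comment> \<open>Self-adjointness allows powers of \<open>E\<close> to be moved across the \<open>H\<close>-product, so that only the total exponent counts.\<close>
  have shift: "(matrix_pow E i *v w) \<bullet> (H *v (matrix_pow E j *v w)) = c w (i + j)" for w i j
  proof (induction i arbitrary: j)
    case 0
    show ?case by (simp add: c_def)
  next
    case (Suc i)
    have "(matrix_pow E (Suc i) *v w) \<bullet> (H *v (matrix_pow E j *v w))
        = (matrix_pow E i *v w) \<bullet> (H *v (matrix_pow E (Suc j) *v w))"
      by (simp add: adj flip: matrix_vector_mul_assoc)
    then show ?case using Suc.IH[of "Suc j"] by simp
  qed
  \<comment> \<open>Even exponents give values of \<open>H\<close>, odd ones give values of \<open>H - N\<close>.\<close>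
  have c_nonneg: "0 \<le> c w m" for w m
  proof (cases "even m")
    case True
    then obtain k where "m = k + k" by (metis evenE mult_2)
    then show ?thesis
      using order_trans[OF N0 NH, of "matrix_pow E k *v w"] by (simp only: shift)
  next
    case False
    then obtain k where "m = 2 * k + 1" by (elim oddE)
    then have k: "m = k + Suc k" by simp
    let ?w = "matrix_pow E k *v w"
    have "c w m = ?w \<bullet> (H *v (E *v ?w))"
      unfolding k shift[symmetric] by (simp flip: matrix_vector_mul_assoc)
    then show ?thesis using NH[of ?w] by (simp add: HE_vec inner_diff_right)
  qed
  define a where "a = (\<lambda>m. c z m - c z (Suc m))"
  have "a (Suc m) \<le> a m" for m
  proof -
    \<comment> \<open>The second difference of \<open>c z\<close> is again of the form \<open>c w\<close>, with \<open>w = z - E z\<close>.\<close>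
    have "c (z - E *v z) m = c z m - 2 * c z (Suc m) + c z (Suc (Suc m))"
      by (simp add: c_def matrix_vector_mult_diff_distrib inner_diff_left inner_diff_right adj pow_E
          flip: matrix_vector_mul_assoc)
    then show ?thesis using c_nonneg[of "z - E *v z" m] by (simp add: a_def)
  qed
  then have dec: "decseq a" by (simp add: decseq_Suc_iff)
  have "(2 * real \<nu> + 1) * a (2 * \<nu>) = (\<Sum>m<2*\<nu>+1. a (2 * \<nu>))" by simp
  also have "\<dots> \<le> (\<Sum>m<2*\<nu>+1. a m)"
    using dec by (intro sum_mono) (auto simp: decseq_def)
  also have "\<dots> = c z 0 - c z (2 * \<nu> + 1)"
    unfolding a_def by (rule sum_lessThan_telescope')
  also have "\<dots> \<le> z \<bullet> (H *v z)" using c_nonneg[of z "2 * \<nu> + 1"] by (simp add: c_def)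
  also have "a (2 * \<nu>) = (matrix_pow E \<nu> *v z) \<bullet> (N *v (matrix_pow E \<nu> *v z))"
  proof -
    let ?w = "matrix_pow E \<nu> *v z"
    have "a (2 * \<nu>) = ?w \<bullet> (H *v ?w) - ?w \<bullet> (H *v (E *v ?w))"
      using shift[of \<nu> z \<nu>] shift[of \<nu> z "Suc \<nu>"]
      by (simp add: a_def mult_2 flip: matrix_vector_mul_assoc)
    then show ?thesis by (simp add: HE_vec inner_diff_right)
  qed
  finally show ?thesis .
qed

section \<open>The normal matrix and the diagonally scaled operator\<close>

text \<open>
  Entry \<open>(i, j)\<close> of \<open>A D\<^sup>-\<^sup>1 A\<close> vanishes unless some \<open>k\<close> links \<open>i\<close> to \<open>j\<close> in the sparsity graph
  of \<open>A\<close>. Symmetry is what turns the columns of \<open>A\<close> that enter the normal matrix into rows.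
\<close>

lemma nnz_normal_matrix_le:
  assumes sym: "symmetric_matrix A" and d: "\<And>i. d i > 0"
  shows "nnz (normal_matrix (diag_of d) A) \<le> (nnz A)\<^sup>2"
proof -
  let ?N = "normal_matrix (diag_of d) A"
  have "d i \<noteq> 0" for i using d[of i] by simp
  then have "?N = A ** diag_of (\<lambda>i. 1 / d i) ** A"
    using sym by (simp add: normal_matrix_def matrix_inv_diag_of symmetric_matrix_def)
  then have entry: "?N $ i $ j = (\<Sum>k\<in>UNIV. A $ i $ k * (1 / d k) * A $ k $ j)" for i j
    by (simp add: matrix_matrix_mult_def diag_of_nth if_distrib[of "\<lambda>c. _ * c"] cong: if_cong)
  have "card {j. ?N $ i $ j \<noteq> 0} \<le> (nnz A)\<^sup>2" for i
  proof -
    have "{j. ?N $ i $ j \<noteq> 0} \<subseteq> (\<Union>k\<in>{k. A $ i $ k \<noteq> 0}. {j. A $ k $ j \<noteq> 0})"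
    proof
      fix j assume "j \<in> {j. ?N $ i $ j \<noteq> 0}"
      then have "(\<Sum>k\<in>UNIV. A $ i $ k * (1 / d k) * A $ k $ j) \<noteq> 0" by (simp add: entry)
      then obtain k where "A $ i $ k * (1 / d k) * A $ k $ j \<noteq> 0"
        by (rule sum.not_neutral_contains_not_neutral)
      then show "j \<in> (\<Union>k\<in>{k. A $ i $ k \<noteq> 0}. {j. A $ k $ j \<noteq> 0})" by auto
    qed
    then have "card {j. ?N $ i $ j \<noteq> 0} \<le> card (\<Union>k\<in>{k. A $ i $ k \<noteq> 0}. {j. A $ k $ j \<noteq> 0})"
      by (intro card_mono) auto
    also have "\<dots> \<le> (\<Sum>k | A $ i $ k \<noteq> 0. card {j. A $ k $ j \<noteq> 0})"
      by (rule card_UN_le) simp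
    also have "\<dots> \<le> (\<Sum>k | A $ i $ k \<noteq> 0. nnz A)"
      by (intro sum_mono card_row_le_nnz)
    also have "\<dots> \<le> nnz A * nnz A"
      using card_row_le_nnz[of A i] by simp
    finally show ?thesis by (simp add: power2_eq_square)
  qed
  then show ?thesis unfolding nnz_def[of ?N] by (subst Max_le_iff) auto
qed

lemma nnz_pos:
  assumes "invertible A"
  shows "0 < nnz A"
proof (rule ccontr)
  assume "\<not> 0 < nnz A"
  then have "card {j. A $ i $ j \<noteq> 0} = 0" for i
    using card_row_le_nnz[of A i] by simp
  then have "A = 0" by (simp add: vec_eq_iff)
  then have "mat 1 = (0 :: real^'a^'a)"
    using matrix_inv_mult(1)[OF assms] by (simp add: matrix_matrix_mult_def vec_eq_iff)
  then have "mat 1 $ i $ i = (0::real)" for i :: 'a by simp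
  then show False by (simp add: mat_def)
qed

lemma norm_transpose_mult_le:
  fixes M :: "('n::finite) sqmat"
  assumes "\<And>x. norm (M *v x) \<le> norm x"
  shows "norm (transpose M *v x) \<le> norm x"
proof (cases "transpose M *v x = 0")
  case False
  let ?y = "transpose M *v x"
  have "(norm ?y)\<^sup>2 = (M *v ?y) \<bullet> x"
    by (metis inner_transpose_mult power2_norm_eq_inner)
  also have "\<dots> \<le> norm (M *v ?y) * norm x" by (rule norm_cauchy_schwarz)
  also have "\<dots> \<le> norm ?y * norm x" using assms by (intro mult_right_mono) auto
  finally show ?thesis using False by (simp add: power2_eq_square del: transpose_matrix_vector)
next
  case True
  then show ?thesis by (simp only: norm_zero norm_ge_zero)
qed

text \<open>
  With \<open>W = R\<^sup>-\<^sup>1 A R\<^sup>-\<^sup>1\<close> the factorisation \<open>J A J = (R J)\<^sup>T W (R J)\<close> has contractions on both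
  sides of \<open>W\<close>.
\<close>

lemma scaled_norm_le:
  fixes A J R :: "('n::finite) sqmat"
  assumes R: "symmetric_matrix R" "invertible R" and J: "symmetric_matrix J"
    and RJ: "\<And>x. norm (R *v (J *v x)) \<le> norm x"
    and A: "spectral_norm (matrix_inv R ** A ** matrix_inv R) \<le> C" and "0 \<le> C"
  shows "norm (J *v (A *v (J *v y))) \<le> C * norm y"
proof -
  let ?W = "matrix_inv R ** A ** matrix_inv R"
  have "R ** ?W ** R = (R ** matrix_inv R) ** A ** (matrix_inv R ** R)"
    by (simp only: matrix_mul_assoc)
  also have "\<dots> = A" by (simp add: matrix_inv_mult R)
  finally have "A *v (J *v y) = R *v (?W *v (R *v (J *v y)))"
    by (metis matrix_vector_mul_assoc)
  then have "norm (J *v (A *v (J *v y))) = norm (transpose (R ** J) *v (?W *v (R *v (J *v y))))"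
    using R(1) J
    by (simp only: matrix_transpose_mul symmetric_matrix_def matrix_vector_mul_assoc[symmetric])
  also have "\<dots> \<le> norm (?W *v (R *v (J *v y)))"
    by (rule norm_transpose_mult_le) (simp add: RJ flip: matrix_vector_mul_assoc)
  also have "\<dots> \<le> spectral_norm ?W * norm (R *v (J *v y))"
    by (rule onorm) simp
  also have "\<dots> \<le> C * norm y"
    using A RJ \<open>0 \<le> C\<close> by (intro mult_mono) auto
  finally show ?thesis .
qed

text \<open>
  In terms of \<open>z = J y\<close>, the comparison \<open>z \<bullet> H z \<le> (nnz A)\<^sup>4 (\<Sum>i. N\<^sub>i\<^sub>i z\<^sub>i\<^sup>2)\<close> is scaled back to \<open>y\<close>:
  as \<open>J\<close> is diagonal, \<open>N\<^sub>i\<^sub>i z\<^sub>i\<^sup>2\<close> is the squared norm of \<open>J A J\<close> applied to \<open>y\<^sub>i e\<^sub>i\<close>.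
\<close>

lemma slsgs_smoothing_bound:
  fixes A :: "('n::{finite,linorder}) sqmat" and d :: "'n \<Rightarrow> real"
  defines "J \<equiv> diag_of (\<lambda>i. 1 / sqrt (d i))" and "N \<equiv> normal_matrix (diag_of d) A"
  assumes sym: "symmetric_matrix A" and inv: "invertible A" and d: "\<And>i. d i > 0"
    and bound: "\<And>y. norm (J *v (A *v (J *v y))) \<le> C * norm y"
  shows "(2 * real \<nu> + 1)
      * (norm (J *v (A *v (matrix_pow (mat 1 - matrix_inv (symmetric_gauss_seidel N) ** N) \<nu> *v (J *v y)))))\<^sup>2
    \<le> (real (nnz A) ^ 2 * C * norm y)\<^sup>2"
proof -
  let ?H = "symmetric_gauss_seidel N"
  let ?E = "mat 1 - matrix_inv ?H ** N"
  have d0: "d i \<noteq> 0" for i using d[of i] by simp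
  have symJ: "symmetric_matrix J" by (simp add: J_def symmetric_diag_of)
  have "matrix_inv (diag_of d) = J ** J"
    using d d0 by (simp add: J_def diag_of_mult matrix_inv_diag_of less_imp_le)
  then have N_eq: "N *v x = A *v (J *v (J *v (A *v x)))" for x
    using sym by (simp add: N_def normal_matrix_def symmetric_matrix_def
        flip: matrix_vector_mul_assoc)
  have form: "x \<bullet> (N *v y) = (J *v (A *v x)) \<bullet> (J *v (A *v y))" for x y
    by (simp add: N_eq symmetric_matrix_inner[OF sym] symmetric_matrix_inner[OF symJ])
  have symN: "symmetric_matrix N"
  proof (rule symmetric_matrixI)
    fix x y
    have "(N *v x) \<bullet> y = y \<bullet> (N *v x)" by (rule inner_commute)
    then show "x \<bullet> (N *v y) = (N *v x) \<bullet> y" by (simp only: form inner_commute)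
  qed
  have pdN: "pos_def N"
    unfolding pos_def_def
  proof (intro allI impI)
    fix x :: "(real, 'n) vec" assume "x \<noteq> 0"
    have "J *v (A *v x) \<noteq> 0"
    proof
      assume "J *v (A *v x) = 0"
      then have "(J *v (A *v x)) $ i = 0" for i by simp
      then have "A *v x = 0" using d0 by (simp add: vec_eq_iff J_def diag_of_mult_vec)
      then have "matrix_inv A *v (A *v x) = 0" by simp
      then show False using \<open>x \<noteq> 0\<close> matrix_inv_mult(2)[OF inv] by (simp add: matrix_vector_mul_assoc)
    qed
    then show "0 < x \<bullet> (N *v x)" by (simp add: form)
  qed
  have NH: "x \<bullet> (N *v x) \<le> x \<bullet> (?H *v x)" for x
    by (rule symmetric_gauss_seidel_ge[OF symN pdN])
  have "pos_def ?H"
    using pdN NH unfolding pos_def_def by (meson less_le_trans)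
  then have "invertible ?H" by (rule pos_def_invertible)
  then have H_inv: "?H *v (matrix_inv ?H *v x) = x" for x
    by (simp add: matrix_vector_mul_assoc matrix_inv_mult)
  have "?H *v (?E *v x) = ?H *v x - N *v x" for x
    by (simp add: matrix_vector_mult_diff_rdistrib matrix_vector_mult_diff_distrib H_inv
        flip: matrix_vector_mul_assoc)
  then have HE: "?H ** ?E = ?H - N"
    by (simp add: matrix_eq matrix_vector_mult_diff_rdistrib flip: matrix_vector_mul_assoc)
  let ?z = "J *v y"
  have "(2 * real \<nu> + 1) * (norm (J *v (A *v (matrix_pow ?E \<nu> *v ?z))))\<^sup>2 \<le> ?z \<bullet> (?H *v ?z)"
    using smoothing_energy[OF symN symmetric_symmetric_gauss_seidel[OF pdN] pos_def_nonneg[OF pdN] NH HE,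
        of \<nu> ?z]
    by (simp only: form power2_norm_eq_inner)
  also have "\<dots> \<le> (real (nnz N))\<^sup>2 * (\<Sum>i\<in>UNIV. N $ i $ i * (?z $ i)\<^sup>2)"
    by (rule symmetric_gauss_seidel_le[OF symN pdN])
  also have "\<dots> \<le> (real (nnz A) ^ 2)\<^sup>2 * (\<Sum>i\<in>UNIV. C\<^sup>2 * (y $ i)\<^sup>2)"
  proof (rule mult_mono[OF power_mono sum_mono])
    show "real (nnz N) \<le> real (nnz A) ^ 2"
      unfolding N_def of_nat_power[symmetric] of_nat_le_iff by (rule nnz_normal_matrix_le[OF sym d])
    fix i
    have "J *v (y $ i *\<^sub>R axis i 1) = ?z $ i *\<^sub>R axis i 1"
      by (simp add: J_def vec_eq_iff diag_of_mult_vec axis_def)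
    then have col: "J *v (A *v (J *v (y $ i *\<^sub>R axis i 1))) = ?z $ i *\<^sub>R (J *v (A *v axis i 1))"
      by (simp only: matrix_vector_mult_scaleR)
    have "N $ i $ i = (norm (J *v (A *v axis i 1)))\<^sup>2"
      unfolding matrix_entry_inner form power2_norm_eq_inner ..
    then have "N $ i $ i * (?z $ i)\<^sup>2 = (norm (J *v (A *v (J *v (y $ i *\<^sub>R axis i 1)))))\<^sup>2"
      unfolding col by (simp add: power_mult_distrib)
    also have "\<dots> \<le> (C * norm (y $ i *\<^sub>R (axis i 1 :: (real, 'n) vec)))\<^sup>2"
      by (intro power_mono bound) simp
    also have "\<dots> = C\<^sup>2 * (y $ i)\<^sup>2" by (simp add: power_mult_distrib)
    finally show "N $ i $ i * (?z $ i)\<^sup>2 \<le> C\<^sup>2 * (y $ i)\<^sup>2" .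
  next
    show "0 \<le> (\<Sum>i\<in>UNIV. N $ i $ i * (?z $ i)\<^sup>2)"
      using pos_def_diagonal_entry[OF pdN] by (simp add: sum_nonneg less_imp_le)
  qed simp_all
  also have "(\<Sum>i\<in>UNIV. C\<^sup>2 * (y $ i)\<^sup>2) = C\<^sup>2 * (norm y)\<^sup>2"
    by (simp add: norm_vec_def L2_set_def sum_nonneg sum_distrib_left)
  finally show ?thesis by (simp add: power_mult_distrib)
qed

theorem lemma1:
  fixes A Q L :: "('n::{finite,linorder}) sqmat"
    and C_low C_up :: real
  assumes A_sym: "symmetric_matrix A"
    and A_inv: "invertible A"
    and Q_sym: "symmetric_matrix Q"
    and Q_pd: "pos_def Q"
    and C_low_pos: "C_low > 0"
    and C_up_pos: "C_up > 0"
    and A_bound: "spectral_norm (matrix_inv_sqrt Q ** A ** matrix_inv_sqrt Q) \<le> C_up"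
    and A_inv_bound: "spectral_norm (matrix_sqrt Q ** matrix_inv A ** matrix_sqrt Q) \<le> inverse C_low"
    and L_diag: "diagonal_matrix L"
    and L_pd: "pos_def L"
    and Q_le_L: "\<And>x. norm (matrix_sqrt Q *v x) \<le> norm (matrix_sqrt L *v x)"
  shows "smoothing_property L A (slsgs_approx_inv L A)
           (\<lambda>\<nu>. 2 powr (- 1 / 2) * C_up * real (nnz A) powr (5 / 2) / sqrt (real \<nu>)) \<and>
         (\<forall>\<nu>\<ge>1. spectral_norm
            (matrix_inv_sqrt L ** A **
               matrix_pow (mat 1 - matrix_inv (symmetric_gauss_seidel (normal_matrix L A)) ** normal_matrix L A) \<nu>
               ** matrix_inv_sqrt L)
          \<le> 2 powr (- 1 / 2) * C_up * real (nnz A) powr (5 / 2) / sqrt (real \<nu>))"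
proof -
  define d where "d = (\<lambda>i. L $ i $ i)"
  have d: "d i > 0" for i unfolding d_def by (rule pos_def_diagonal_entry[OF L_pd])
  have L_eq: "L = diag_of d"
    using L_diag by (simp add: diagonal_matrix_def diag_of_def d_def vec_eq_iff)
  define J where "J = diag_of (\<lambda>i. 1 / sqrt (d i))"
  have sqrt_L: "matrix_sqrt L = diag_of (\<lambda>i. sqrt (d i))"
    unfolding L_eq by (rule matrix_sqrt_diag_of[OF d])
  have sqrt_d: "sqrt (d i) \<noteq> 0" for i using d[of i] by simp
  have J_eq: "matrix_inv_sqrt L = J"
    unfolding matrix_inv_sqrt_def sqrt_L J_def by (rule matrix_inv_diag_of[OF sqrt_d])
  have "matrix_sqrt L *v (J *v x) = x" for x
    unfolding sqrt_L J_def using sqrt_d by (simp add: vec_eq_iff diag_of_mult_vec)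
  then have RJ: "norm (matrix_sqrt Q *v (J *v x)) \<le> norm x" for x
    using Q_le_L[of "J *v x"] by simp
  have JAJ: "norm (J *v (A *v (J *v y))) \<le> C_up * norm y" for y
  proof (rule scaled_norm_le[of "matrix_sqrt Q"])
    show "symmetric_matrix (matrix_sqrt Q)" by (rule symmetric_matrix_sqrt[OF Q_sym Q_pd])
    show "invertible (matrix_sqrt Q)"
      by (rule pos_def_invertible[OF pos_def_matrix_sqrt[OF Q_sym Q_pd]])
    show "symmetric_matrix J" by (simp add: J_def symmetric_diag_of)
    show "spectral_norm (matrix_inv (matrix_sqrt Q) ** A ** matrix_inv (matrix_sqrt Q)) \<le> C_up"
      using A_bound by (simp add: matrix_inv_sqrt_def)
  qed (use RJ C_up_pos in auto)
  let ?N = "normal_matrix L A"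
  let ?E = "mat 1 - matrix_inv (symmetric_gauss_seidel ?N) ** ?N"
  let ?\<eta> = "\<lambda>\<nu>. 2 powr (- 1 / 2) * C_up * real (nnz A) powr (5 / 2) / sqrt (real \<nu>)"
  have n: "1 \<le> real (nnz A)" using nnz_pos[OF A_inv] by simp
  have bound: "spectral_norm (matrix_inv_sqrt L ** A ** matrix_pow ?E \<nu> ** matrix_inv_sqrt L) \<le> ?\<eta> \<nu>"
    if "\<nu> \<ge> 1" for \<nu>
  proof (rule onorm_le)
    fix y :: "(real, 'n) vec"
    let ?w = "J *v (A *v (matrix_pow ?E \<nu> *v (J *v y)))"
    have \<nu>: "0 < real \<nu>" using that by simp
    \<comment> \<open>Replacing \<open>2 \<nu> + 1\<close> by \<open>2 \<nu>\<close> produces the factor \<open>2 powr (- 1 / 2)\<close> of the claim.\<close>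
    have "2 * real \<nu> * (norm ?w)\<^sup>2 \<le> (2 * real \<nu> + 1) * (norm ?w)\<^sup>2"
      by (intro mult_right_mono) auto
    also have "\<dots> \<le> (real (nnz A) ^ 2 * C_up * norm y)\<^sup>2"
      using slsgs_smoothing_bound[OF A_sym A_inv d JAJ[unfolded J_def], of \<nu> y]
      by (simp only: J_def L_eq)
    finally have "(sqrt (2 * real \<nu>) * norm ?w)\<^sup>2 \<le> (real (nnz A) ^ 2 * C_up * norm y)\<^sup>2"
      by (simp add: power_mult_distrib)
    then have "sqrt (2 * real \<nu>) * norm ?w \<le> real (nnz A) ^ 2 * C_up * norm y"
      by (rule power2_le_imp_le) (use C_up_pos in simp)
    \<comment> \<open>The estimate has the exponent 2; it may be raised to 5/2 because \<open>nnz A \<ge> 1\<close>.\<close>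
    also have "real (nnz A) ^ 2 = real (nnz A) powr 2" using n by simp
    also have "\<dots> \<le> real (nnz A) powr (5 / 2)" using n by (intro powr_mono) auto
    finally have scaled: "sqrt 2 * sqrt (real \<nu>) * norm ?w \<le> real (nnz A) powr (5 / 2) * C_up * norm y"
      using C_up_pos by (simp add: real_sqrt_mult mult_right_mono)
    have "2 powr (- 1 / 2) = 1 / sqrt (2::real)"
      by (simp add: powr_minus_divide powr_half_sqrt)
    then have "?\<eta> \<nu> * norm y = real (nnz A) powr (5 / 2) * C_up * norm y / (sqrt 2 * sqrt (real \<nu>))"
      by simp
    moreover have "norm ?w \<le> real (nnz A) powr (5 / 2) * C_up * norm y / (sqrt 2 * sqrt (real \<nu>))"
      using scaled \<nu> by (simp add: pos_le_divide_eq ac_simps)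
    ultimately have "norm ?w \<le> ?\<eta> \<nu> * norm y" by simp
    then show "norm ((matrix_inv_sqrt L ** A ** matrix_pow ?E \<nu> ** matrix_inv_sqrt L) *v y) \<le> ?\<eta> \<nu> * norm y"
      by (simp only: J_eq flip: matrix_vector_mul_assoc)
  qed
  moreover have "?\<eta> \<longlonglongrightarrow> 0"
    by (intro tendsto_divide_0[OF tendsto_const] filterlim_at_top_imp_at_infinity
        filterlim_compose[OF sqrt_at_top filterlim_real_sequentially])
  ultimately show ?thesis
    unfolding smoothing_property_def slsgs_iteration_matrix by blast
qed

end
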